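(* Let $v$ be a leaf node with samples $(\mathbf{x}_1,y_1),\dots,(\mathbf{x}_n,y_n)$, $n\ge 1$, $y_i\in\{+1,-1\}$, and suppose the label noise rates satisfy $\eta_{\mathbf{x}}<0.5$ for all $\mathbf{x}$. Let $p$ and $q=1-p$ be the fractions of positive and negative samples at $v$ in the noise-free data, and $p^{\eta}$, $q^{\eta}=1-p^{\eta}$ their large-sample values under the label noise. (a) Majority voting at $v$ is robust to symmetric label noise: if $\eta_{\mathbf{x}}=\eta$ for all $\mathbf{x}$, then $p>q$ implies $p^{\eta}>q^{\eta}$, and $p<q$ implies $p^{\eta}<q^{\eta}$. (b) Majority voting at $v$ is also robust to non-uniform label noise (with $\eta_{\mathbf{x}}$ an arbitrary function of $\mathbf{x}$ taking values below $0.5$) if all the points at $v$ belong to one class in the noise-free data: if $p=1$ then $p^{\eta}>q^{\eta}$, and if $q=1$ then $q^{\eta}>p^{\eta}$.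
   Context: Label noise model: a sample $\mathbf{x}$ with true label $y_{\mathbf{x}}\in\{+1,-1\}$ receives the noisy label $\tilde y_{\mathbf{x}}=-y_{\mathbf{x}}$ with probability $\eta_{\mathbf{x}}\in[0,1]$ and $\tilde y_{\mathbf{x}}=y_{\mathbf{x}}$ with probability $1-\eta_{\mathbf{x}}$, independently across samples. The noise is symmetric if $\eta_{\mathbf{x}}=\eta$ is constant, and non-uniform if $\eta_{\mathbf{x}}$ is a general function of $\mathbf{x}$. Majority voting assigns to a leaf the class having the larger fraction of samples. Robustness is meant in the large-sample sense: the majority class determined by the large-sample noisy fractions is the same as the majority class in the noise-free data. The large-sample noisy fraction $p^{\eta}$ is obtained by replacing each label-flip indicator by its expectation, i.e. $p^{\eta}=E[\tilde p]$, where $\tilde p$ is the fraction of samples at $v$ with noisy label $+1$. Explicitly $p^{\eta}=\frac1n\Bigl(\sum_{i:y_i=+1}(1-\eta_{\mathbf{x}_i})+\sum_{i:y_i=-1}\eta_{\mathbf{x}_i}\Bigr)$. *)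

theory Defs
  imports "HOL-Probability.Product_PMF"
begin

text \<open>
  The samples at a leaf are \<open>(x i, y i)\<close> for \<open>i \<in> {1..n}\<close>, with labels \<open>y i \<in> {1, -1}\<close>.
\<close>

definition class_fraction :: "nat \<Rightarrow> (nat \<Rightarrow> int) \<Rightarrow> int \<Rightarrow> real" where
  "class_fraction n y c = real (card {i \<in> {1..n}. y i = c}) / real n"

text \<open>
  \<^const>\<open>bernoulli_pmf\<close> clips its parameter to \<open>[0,1]\<close>, so \<open>r\<close> is meant to be a probability.
\<close>

definition noisy_label :: "real \<Rightarrow> int \<Rightarrow> int pmf" where
  "noisy_label r l = map_pmf (\<lambda>flip. if flip then - l else l) (bernoulli_pmf r)"

text \<open>
  Independence across samples is the product measure over the index set; the default value \<open>0\<close>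
  taken outside \<open>{1..n}\<close> is irrelevant.
\<close>

definition noisy_labels ::
    "('a \<Rightarrow> real) \<Rightarrow> nat \<Rightarrow> (nat \<Rightarrow> 'a) \<Rightarrow> (nat \<Rightarrow> int) \<Rightarrow> (nat \<Rightarrow> int) pmf" where
  "noisy_labels \<eta> n x y = Pi_pmf {1..n} 0 (\<lambda>i. noisy_label (\<eta> (x i)) (y i))"

definition large_sample_fraction ::
    "('a \<Rightarrow> real) \<Rightarrow> nat \<Rightarrow> (nat \<Rightarrow> 'a) \<Rightarrow> (nat \<Rightarrow> int) \<Rightarrow> int \<Rightarrow> real" where
  "large_sample_fraction \<eta> n x y c =
     measure_pmf.expectation (noisy_labels \<eta> n x y) (\<lambda>z. class_fraction n z c)"

lemma class_fraction_conv_sum: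
  "class_fraction n y c = (\<Sum>i=1..n. of_bool (y i = c)) / real n"
proof -
  have "(\<Sum>i=1..n. of_bool (y i = c)) = real (card ({1..n} \<inter> {i. y i = c}))"
    by (subst sum_of_bool_eq) auto
  moreover have "{1..n} \<inter> {i. y i = c} = {i \<in> {1..n}. y i = c}" by auto
  ultimately show ?thesis by (simp add: class_fraction_def)
qed

lemma finite_set_pmf_noisy_labels: "finite (set_pmf (noisy_labels \<eta> n x y))"
proof -
  have "finite (set_pmf (noisy_label r l))" for r l
    unfolding noisy_label_def by simp
  then show ?thesis
    unfolding noisy_labels_def
    by (intro finite_subset[OF set_Pi_pmf_subset'] finite_PiE_dflt) auto
qed

lemma large_sample_fraction_conv_prob:
  "large_sample_fraction \<eta> n x y c =
     (\<Sum>i=1..n. pmf (noisy_label (\<eta> (x i)) (y i)) c) / real n"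
proof -
  let ?M = "noisy_labels \<eta> n x y"
  have int: "integrable ?M (f :: _ \<Rightarrow> real)" for f
    by (rule integrable_measure_pmf_finite[OF finite_set_pmf_noisy_labels])
  have comp: "measure_pmf.expectation ?M (\<lambda>z. of_bool (z i = c)) =
      pmf (noisy_label (\<eta> (x i)) (y i)) c" if "i \<in> {1..n}" for i
  proof -
    have "measure_pmf.expectation ?M (\<lambda>z. of_bool (z i = c)) =
        measure_pmf.expectation (map_pmf (\<lambda>z. z i) ?M) (\<lambda>l. of_bool (l = c) :: real)"
      by simp
    also have "map_pmf (\<lambda>z. z i) ?M = noisy_label (\<eta> (x i)) (y i)"
      unfolding noisy_labels_def using that by (subst Pi_pmf_component) auto
    also have "measure_pmf.expectation (noisy_label (\<eta> (x i)) (y i)) (\<lambda>l. of_bool (l = c)) =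
        measure_pmf.expectation (noisy_label (\<eta> (x i)) (y i)) (indicator {c} :: _ \<Rightarrow> real)"
      by (intro Bochner_Integration.integral_cong) (auto simp: indicator_def)
    also have "\<dots> = pmf (noisy_label (\<eta> (x i)) (y i)) c"
      by (simp add: pmf.rep_eq)
    finally show ?thesis .
  qed
  have "measure_pmf.expectation ?M (\<lambda>z. \<Sum>i=1..n. of_bool (z i = c)) =
      (\<Sum>i=1..n. measure_pmf.expectation ?M (\<lambda>z. of_bool (z i = c)) :: real)"
    by (rule Bochner_Integration.integral_sum[OF int])
  also have "\<dots> = (\<Sum>i=1..n. pmf (noisy_label (\<eta> (x i)) (y i)) c)"
    by (rule sum.cong[OF refl comp])
  finally show ?thesis
    unfolding large_sample_fraction_def class_fraction_conv_sum
    by (simp del: sum_of_bool_eq)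
qed

lemma pmf_noisy_label:
  assumes "r \<in> {0..1}" "l \<in> {1, -1}"
  shows "pmf (noisy_label r l) 1 = (if l = 1 then 1 - r else r)"
    and "pmf (noisy_label r l) (-1) = (if l = 1 then r else 1 - r)"
proof -
  have vimage: "(\<lambda>b. if b then - l else l) -` {c} =
      {b. (if b then - l else l) = c}" for c :: int
    by auto
  have sets: "{b. b} = {True}" "{b. \<not> b} = {False}" by auto
  show "pmf (noisy_label r l) 1 = (if l = 1 then 1 - r else r)"
    and "pmf (noisy_label r l) (-1) = (if l = 1 then r else 1 - r)"
    using assms
    by (auto simp: noisy_label_def pmf_map vimage measure_pmf_single sets if_distrib cong: if_cong)
qed

lemma class_fraction_neg:
  assumes "n \<ge> 1" "\<And>i. i \<in> {1..n} \<Longrightarrow> y i \<in> {1, -1}"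
  shows "class_fraction n y (-1) = 1 - class_fraction n y 1"
proof -
  have "(\<Sum>i=1..n. of_bool (y i = -1)) = (\<Sum>i=1..n. 1 - of_bool (y i = 1) :: real)"
  proof (rule sum.cong)
    fix i assume "i \<in> {1..n}"
    with assms(2) have "y i \<in> {1, -1}" by blast
    then show "of_bool (y i = -1) = (1 - of_bool (y i = 1) :: real)" by auto
  qed simp
  then show ?thesis
    using assms(1) by (simp add: class_fraction_conv_sum sum_subtractf diff_divide_distrib)
qed

lemma large_sample_fraction_neg:
  assumes "n \<ge> 1" "\<And>i. i \<in> {1..n} \<Longrightarrow> y i \<in> {1, -1}" "\<And>z. \<eta> z \<in> {0..1}"
  shows "large_sample_fraction \<eta> n x y (-1) = 1 - large_sample_fraction \<eta> n x y 1"
proof -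
  have "(\<Sum>i=1..n. pmf (noisy_label (\<eta> (x i)) (y i)) (-1)) =
      (\<Sum>i=1..n. 1 - pmf (noisy_label (\<eta> (x i)) (y i)) 1)"
    using assms(2,3) by (intro sum.cong) (simp_all only: pmf_noisy_label split: if_splits, auto)
  then show ?thesis
    using assms(1)
    by (simp add: large_sample_fraction_conv_prob sum_subtractf diff_divide_distrib)
qed

lemma large_sample_fraction_pos_explicit:
  assumes "\<And>i. i \<in> {1..n} \<Longrightarrow> y i \<in> {1, -1}" "\<And>z. \<eta> z \<in> {0..1}"
  shows "large_sample_fraction \<eta> n x y 1 =
    ((\<Sum>i\<in>{i \<in> {1..n}. y i = 1}. 1 - \<eta> (x i)) + (\<Sum>i\<in>{i \<in> {1..n}. y i = -1}. \<eta> (x i))) / real n"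
proof -
  have split: "{1..n} = {i \<in> {1..n}. y i = 1} \<union> {i \<in> {1..n}. y i = -1}"
    using assms(1) by blast
  have "(\<Sum>i=1..n. pmf (noisy_label (\<eta> (x i)) (y i)) 1) =
      (\<Sum>i=1..n. if y i = 1 then 1 - \<eta> (x i) else \<eta> (x i))"
    using assms by (intro sum.cong pmf_noisy_label(1)) auto
  also have "\<dots> = (\<Sum>i\<in>{i \<in> {1..n}. y i = 1}. if y i = 1 then 1 - \<eta> (x i) else \<eta> (x i)) +
      (\<Sum>i\<in>{i \<in> {1..n}. y i = -1}. if y i = 1 then 1 - \<eta> (x i) else \<eta> (x i))"
    by (subst split, rule sum.union_disjoint) auto
  finally show ?thesis
    by (simp add: large_sample_fraction_conv_prob)
qed

end

theory Submission
  imports Defs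
begin

text \<open>
  Flipping a label with probability \<open>\<eta>\<close> multiplies its expectation by \<open>1 - 2 * \<eta> > 0\<close>, so the
  margin of the large-sample fractions is the mean of \<open>(1 - 2 * \<eta> (x i)) * y i\<close>, whereas the
  noise-free margin is the mean of \<open>y i\<close>. A constant factor preserves the sign of the mean, and
  arbitrary positive factors preserve it if all labels agree.
\<close>

text \<open>For a label in {1, -1}, the indicator of class 1 minus that of class -1 is the label
  itself.\<close>

lemma class_fraction_margin:
  assumes "\<And>i. i \<in> {1..n} \<Longrightarrow> y i \<in> {1, -1}"
  shows "class_fraction n y 1 - class_fraction n y (-1) = (\<Sum>i=1..n. real_of_int (y i)) / real n"
proof -
  have "(\<Sum>i=1..n. of_bool (y i = 1)) - (\<Sum>i=1..n. of_bool (y i = -1)) =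
      (\<Sum>i=1..n. of_bool (y i = 1) - of_bool (y i = -1) :: real)"
    by (rule sum_subtractf [symmetric])
  also have "\<dots> = (\<Sum>i=1..n. real_of_int (y i))"
  proof (rule sum.cong)
    fix i assume "i \<in> {1..n}"
    with assms have "y i \<in> {1, -1}" by blast
    then show "of_bool (y i = 1) - of_bool (y i = -1) = real_of_int (y i)" by auto
  qed simp
  finally show ?thesis
    by (simp only: class_fraction_conv_sum diff_divide_distrib [symmetric])
qed

text \<open>By linearity the margin splits into one term per sample, the difference of its two
  noisy-label probabilities. This is (1 - r) - r or its negative for flip rate r, according to the
  sign of the true label.\<close>

lemma large_sample_fraction_margin:
  assumes "\<And>i. i \<in> {1..n} \<Longrightarrow> y i \<in> {1, -1}" "\<And>z. \<eta> z \<in> {0..1}"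
  shows "large_sample_fraction \<eta> n x y 1 - large_sample_fraction \<eta> n x y (-1) =
    (\<Sum>i=1..n. (1 - 2 * \<eta> (x i)) * real_of_int (y i)) / real n"
proof -
  have "(\<Sum>i=1..n. pmf (noisy_label (\<eta> (x i)) (y i)) 1) -
      (\<Sum>i=1..n. pmf (noisy_label (\<eta> (x i)) (y i)) (-1)) =
      (\<Sum>i=1..n. pmf (noisy_label (\<eta> (x i)) (y i)) 1 - pmf (noisy_label (\<eta> (x i)) (y i)) (-1))"
    by (rule sum_subtractf [symmetric])
  also have "\<dots> = (\<Sum>i=1..n. (1 - 2 * \<eta> (x i)) * real_of_int (y i))"
  proof (rule sum.cong)
    fix i assume "i \<in> {1..n}"
    with assms(1) have "y i \<in> {1, -1}" by blast
    with pmf_noisy_label [OF assms(2) this]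
    show "pmf (noisy_label (\<eta> (x i)) (y i)) 1 - pmf (noisy_label (\<eta> (x i)) (y i)) (-1) =
        (1 - 2 * \<eta> (x i)) * real_of_int (y i)"
      by auto
  qed simp
  finally show ?thesis
    by (simp only: large_sample_fraction_conv_prob diff_divide_distrib [symmetric])
qed

lemma class_fraction_eq_1D:
  assumes "class_fraction n y c = 1" "i \<in> {1..n}"
  shows "y i = c"
proof -
  have "card {i \<in> {1..n}. y i = c} = card {1..n}"
    using assms by (auto simp: class_fraction_def divide_eq_1_iff)
  then have "{i \<in> {1..n}. y i = c} = {1..n}"
    by (intro card_subset_eq) auto
  then show ?thesis using assms(2) by blast
qed

theorem theorem5:
  fixes n :: nat and x :: "nat \<Rightarrow> 'a" and y :: "nat \<Rightarrow> int" and \<eta> :: "'a \<Rightarrow> real"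
  assumes "n \<ge> 1"
    and "\<And>i. i \<in> {1..n} \<Longrightarrow> y i \<in> {1, -1}"
    and "\<And>z. \<eta> z \<in> {0..1}"
    and "\<And>z. \<eta> z < 1 / 2"
  shows
    "(\<forall>e. (\<forall>z. \<eta> z = e) \<longrightarrow>
        (class_fraction n y 1 > class_fraction n y (-1) \<longrightarrow>
           large_sample_fraction \<eta> n x y 1 > large_sample_fraction \<eta> n x y (-1)) \<and>
        (class_fraction n y 1 < class_fraction n y (-1) \<longrightarrow>
           large_sample_fraction \<eta> n x y 1 < large_sample_fraction \<eta> n x y (-1))) \<and>
     (class_fraction n y 1 = 1 \<longrightarrow>
        large_sample_fraction \<eta> n x y 1 > large_sample_fraction \<eta> n x y (-1)) \<and>
     (class_fraction n y (-1) = 1 \<longrightarrow>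
        large_sample_fraction \<eta> n x y (-1) > large_sample_fraction \<eta> n x y 1)"
proof -
  let ?L = "large_sample_fraction \<eta> n x y" and ?C = "class_fraction n y"
  have C: "?C 1 - ?C (-1) = (\<Sum>i=1..n. real_of_int (y i)) / real n"
    using assms(2) by (rule class_fraction_margin)
  have L: "?L 1 - ?L (-1) = (\<Sum>i=1..n. (1 - 2 * \<eta> (x i)) * real_of_int (y i)) / real n"
    using assms(2,3) by (rule large_sample_fraction_margin)
  have "(?C (-1) < ?C 1 \<longrightarrow> ?L (-1) < ?L 1) \<and> (?C 1 < ?C (-1) \<longrightarrow> ?L 1 < ?L (-1))"
    if "\<And>z. \<eta> z = e" for e
  proof -
    \<comment> \<open>With a constant rate the factor leaves the sum, so the two margins are
      proportional.\<close>
    have "?L 1 - ?L (-1) = (1 - 2 * e) * (?C 1 - ?C (-1))"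
      unfolding L C by (simp add: that flip: sum_distrib_left)
    moreover have "0 < 1 - 2 * e"
      using assms(4) that by simp
    ultimately show ?thesis
      by (smt (verit) zero_less_mult_iff mult_less_0_iff)
  qed
  \<comment> \<open>Multiplying the margin by \<open>c\<close> orients it towards the pure class, so
    one inequality covers both classes.\<close>
  moreover have "0 < real_of_int c * (?L 1 - ?L (-1))" if "?C c = 1" "c \<in> {1, -1}" for c
  proof -
    have "?L 1 - ?L (-1) = (\<Sum>i=1..n. (1 - 2 * \<eta> (x i)) * real_of_int c) / real n"
      using class_fraction_eq_1D [OF that(1)] by (simp add: L)
    \<comment> \<open>The sign cancels because c * c = 1.\<close>
    then have "real_of_int c * (?L 1 - ?L (-1)) = (\<Sum>i=1..n. 1 - 2 * \<eta> (x i)) / real n"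
      using that(2) by (auto simp: sum_negf simp flip: sum_distrib_right)
    also have "0 < \<dots>"
    \<comment> \<open>Strict positivity of the sum rests on a nonempty index set, which
      \<open>n \<ge> 1\<close> supplies.\<close>
    proof (intro divide_pos_pos sum_pos)
      show "0 < 1 - 2 * \<eta> (x i)" for i
        using assms(4) [of "x i"] by simp
    qed (use assms(1) in auto)
    finally show ?thesis .
  qed
  from this [of 1] this [of "-1"]
  have "?C 1 = 1 \<longrightarrow> ?L (-1) < ?L 1" "?C (-1) = 1 \<longrightarrow> ?L 1 < ?L (-1)"
    by auto
  ultimately show ?thesis by blast
qed

end
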